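(* Let $(X,L)$ be a convergence space such that $\mathsf S_{\mathrm{fin}}(\mathcal C_L,\operatorname{Cov}(X))$ holds. Let $\sigma$ be a strategy for Alice in the game $\mathsf G_{\mathrm{fin}}(\mathcal C_L,\operatorname{Cov}(X))$. Suppose that, after every finite position compatible with $\sigma$, the $L$-cover prescribed by $\sigma$ contains a countable subfamily that is an $L$-cover. Then $\sigma$ is not a winning strategy.
   Context: All filters are proper. $\operatorname{Fil}(X)$ is the set of filters on $X$, and $\dot x=\{A\subseteq X:x\in A\}$. A convergence on $X$ is a function $L:\operatorname{Fil}(X)\to\mathcal P(X)$ such that $x\in L(\dot x)$ for every $x\in X$, and $L(\mathcal F)\subseteq L(\mathcal G)$ whenever $\mathcal F\subseteq\mathcal G$; then $(X,L)$ is a convergence space. A family $\mathcal U\subseteq\mathcal P(X)$ is an $L$-cover if $\mathcal U\cap\mathcal F\neq\varnothing$ for every $\mathcal F\in\operatorname{Fil}(X)$ with $L(\mathcal F)\neq\varnothing$; $\mathcal C_L$ is the family of all $L$-covers. $\operatorname{Cov}(X)$ is the family of all covers of $X$ by subsets of $X$. $\mathsf S_{\mathrm{fin}}(\mathcal A,\mathcal B)$ asserts that for every sequence $\langle\mathcal U_n:n<\omega\rangle$ in $\mathcal A$ there are finite $\mathcal V_n\subseteq\mathcal U_n$ with $\bigcup_{n<\omega}\mathcal V_n\in\mathcal B$. In the game $\mathsf G_{\mathrm{fin}}(\mathcal A,\mathcal B)$, in each inning $n<\omega$ Alice chooses $\mathcal U_n\in\mathcal A$ and then Bob chooses a finite subfamily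 $\mathcal V_n\subseteq\mathcal U_n$; Bob wins if $\bigcup_{n<\omega}\mathcal V_n\in\mathcal B$, otherwise Alice wins. A strategy for Alice prescribes her next move at every finite position at which she is to move (including the initial one); a position is compatible with the strategy if all of Alice's earlier moves in it were those prescribed by the strategy. *)

theory Defs
  imports Complex_Main "HOL-Library.Countable_Set"
begin

text \<open>
  A filter on the set \<open>X\<close> is represented by an element \<open>F\<close> of the library type of filters
  on the ambient type that lies below \<open>principal X\<close>; it is proper iff \<open>F \<noteq> bot\<close>. The family
  it stands for is \<open>{A. A \<subseteq> X \<and> (\<forall>\<^sub>F x in F. x \<in> A)}\<close>. The library order
  reverses inclusion of these families: \<open>G \<le> F\<close> says that \<open>F\<close>, seen as a family of sets, is
  contained in \<open>G\<close>. The point filter of \<open>x\<close> is \<open>principal {x}\<close>.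
\<close>

definition Fil :: "'a set \<Rightarrow> 'a filter set" where
  "Fil X = {F. F \<noteq> bot \<and> F \<le> principal X}"

text \<open>The values of \<open>L\<close> outside \<open>Fil X\<close> are irrelevant.\<close>

locale convergence_space =
  fixes X :: "'a set" and L :: "'a filter \<Rightarrow> 'a set"
  assumes lim_subset: "F \<in> Fil X \<Longrightarrow> L F \<subseteq> X"
    and lim_point: "x \<in> X \<Longrightarrow> x \<in> L (principal {x})"
    and lim_mono: "F \<in> Fil X \<Longrightarrow> G \<in> Fil X \<Longrightarrow> G \<le> F \<Longrightarrow> L F \<subseteq> L G"

definition L_covers :: "'a set \<Rightarrow> ('a filter \<Rightarrow> 'a set) \<Rightarrow> 'a set set set" where
  "L_covers X L =
    {\<U>. \<U> \<subseteq> Pow X \<and> (\<forall>F\<in>Fil X. L F \<noteq> {} \<longrightarrow> (\<exists>A\<in>\<U>. \<forall>\<^sub>F x in F. x \<in> A))}"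

definition Cov :: "'a set \<Rightarrow> 'a set set set" where
  "Cov X = {\<U>. \<U> \<subseteq> Pow X \<and> \<Union>\<U> = X}"

definition S_fin :: "'b set set \<Rightarrow> 'b set set \<Rightarrow> bool" where
  "S_fin \<A> \<B> \<longleftrightarrow>
    (\<forall>\<U> :: nat \<Rightarrow> 'b set. (\<forall>n. \<U> n \<in> \<A>) \<longrightarrow>
      (\<exists>\<V>. (\<forall>n. finite (\<V> n) \<and> \<V> n \<subseteq> \<U> n) \<and> (\<Union>n. \<V> n) \<in> \<B>))"

text \<open>
  A finite position of the game at which Alice is to move is the list of the completed innings,
  earliest first, each given as the pair of Alice's move and Bob's answer.
\<close>

definition positions :: "'b set set \<Rightarrow> ('b set \<times> 'b set) list set" where
  "positions \<A> = {p. \<forall>(U, V)\<in>set p. U \<in> \<A> \<and> finite V \<and> V \<subseteq> U}"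

definition alice_strategy :: "'b set set \<Rightarrow> (('b set \<times> 'b set) list \<Rightarrow> 'b set) \<Rightarrow> bool" where
  "alice_strategy \<A> \<sigma> \<longleftrightarrow> (\<forall>p\<in>positions \<A>. \<sigma> p \<in> \<A>)"

definition compatible ::
    "(('b set \<times> 'b set) list \<Rightarrow> 'b set) \<Rightarrow> ('b set \<times> 'b set) list \<Rightarrow> bool" where
  "compatible \<sigma> p \<longleftrightarrow> (\<forall>i<length p. fst (p ! i) = \<sigma> (take i p))"

text \<open>An infinite play \<open>r\<close> is legal, or compatible with \<open>\<sigma>\<close>, iff all its finite initial
  segments are.\<close>

definition alice_winning ::
    "'b set set \<Rightarrow> 'b set set \<Rightarrow> (('b set \<times> 'b set) list \<Rightarrow> 'b set) \<Rightarrow> bool" where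
  "alice_winning \<A> \<B> \<sigma> \<longleftrightarrow>
    (\<forall>r :: nat \<Rightarrow> 'b set \<times> 'b set.
      (\<forall>n. map r [0..<n] \<in> positions \<A> \<and> compatible \<sigma> (map r [0..<n])) \<longrightarrow>
      (\<Union>n. snd (r n)) \<notin> \<B>)"

end

theory Submission imports Defs begin

text \<open>
  This is Hurewicz' argument for the Menger game, with the points of the space replaced by the
  convergent filters. Bob restricts himself to answering with the initial segments of an
  enumeration of a countable \<open>L\<close>-subcover of Alice's move, so his plays are coded by finite
  sequences \<open>s\<close> of numbers; let \<open>U s\<close> be the set covered by his answers along \<open>s\<close>. This set
  grows with \<open>s\<close> and with the last entry of \<open>s\<close>. Put
  \<open>Q n k = (\<Inter>s. U (s\<frown>k))\<close> (the \<open>uniform_core\<close> below), where \<open>s\<close> ranges over all sequences of length at most \<open>n\<close>.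
  Although this is an infinite intersection, monotonicity reduces it to a finite one on a set of
  a given convergent filter, so \<open>{Q n k | k}\<close> is an increasing \<open>L\<close>-cover. Applying
  \<open>S_fin\<close> to these covers yields \<open>f\<close> with \<open>(\<Union>n. Q n (f n)) = X\<close>, and
  \<open>Q n (f n) \<subseteq> U (f 0, \<dots>, f n)\<close>, so Bob wins by following \<open>f\<close>.
\<close>

definition uniform_core :: "(nat list \<Rightarrow> 'a set) \<Rightarrow> nat \<Rightarrow> nat \<Rightarrow> 'a set" where
  "uniform_core U n k = (\<Inter>s\<in>{s. length s \<le> n}. U (k # s))"

lemma uniform_core_subset: "length s \<le> n \<Longrightarrow> uniform_core U n k \<subseteq> U (k # s)"
  by (auto simp: uniform_core_def)

lemma uniform_core_mono:
  assumes "\<And>s k m. k \<le> m \<Longrightarrow> U (k # s) \<subseteq> U (m # s)" and "k \<le> m"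
  shows "uniform_core U n k \<subseteq> uniform_core U n m"
  using assms unfolding uniform_core_def by blast

text \<open>Induction on \<open>n\<close>; let \<open>k\<close> work for \<open>n\<close>. Only
  finitely many lists of length at most \<open>Suc n\<close> have all entries below
  \<open>k\<close>, so one \<open>m\<close> serves them all. Any other such list has an entry
  \<open>j\<close> \<ge> \<open>k\<close>; the part \<open>t\<close> played before \<open>j\<close>
  has length at most \<open>n\<close>, so points of \<open>uniform_core U n k\<close> lie in
  \<open>U (j # t)\<close> and stay in \<open>U\<close> along every extension.\<close>

lemma uniform_core_eventually:
  fixes U :: "nat list \<Rightarrow> 'a set"
  assumes ext: "\<And>m s. U s \<subseteq> U (m # s)"
    and mono: "\<And>s k m. k \<le> m \<Longrightarrow> U (k # s) \<subseteq> U (m # s)"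
    and ev: "\<And>s. \<exists>m. \<forall>\<^sub>F x in F. x \<in> U (m # s)"
  shows "\<exists>k. \<forall>\<^sub>F x in F. x \<in> uniform_core U n k"
proof (induction n)
  case 0
  show ?case using ev[of "[]"] by (simp add: uniform_core_def)
next
  case (Suc n)
  then obtain k where k: "\<forall>\<^sub>F x in F. x \<in> uniform_core U n k" by blast
  obtain g where g: "\<And>s. \<forall>\<^sub>F x in F. x \<in> U (g s # s)" using ev by metis
  define S where "S = {s. set s \<subseteq> {..<k} \<and> length s \<le> Suc n}"
  have fin: "finite S" unfolding S_def by (rule finite_lists_length_le) simp
  define m where "m = Max (g ` S)"
  have "\<forall>\<^sub>F x in F. x \<in> U (m # s)" if "s \<in> S" for s
  proof (rule eventually_mono[OF g])
    have "U (g s # s) \<subseteq> U (m # s)"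
      using that fin by (intro mono) (simp add: m_def)
    then show "x \<in> U (m # s)" if "x \<in> U (g s # s)" for x
      using that by (rule subsetD)
  qed
  then have "\<forall>\<^sub>F x in F. \<forall>s\<in>S. x \<in> U (m # s)"
    by (intro eventually_ball_finite[OF fin] ballI)
  with k have "\<forall>\<^sub>F x in F. x \<in> uniform_core U (Suc n) m"
  proof eventually_elim
    case (elim x)
    have "x \<in> U (m # s)" if len: "length s \<le> Suc n" for s
    proof (cases "s \<in> S")
      case True
      then show ?thesis using elim by blast
    next
      case False
      then obtain j where "j \<in> set s" and j: "k \<le> j"
        using len by (auto simp: S_def subset_iff not_less)
      then obtain u t where s: "s = u @ j # t" by (meson split_list)
      have "length t \<le> n" using len s by simp
      from subsetD[OF uniform_core_subset[OF this] elim(1)] have "x \<in> U (j # t)"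
        by (rule subsetD[OF mono[OF j]])
      then have "x \<in> U (u @ j # t)"
      proof (induction u)
        case (Cons i u)
        then show ?case using subsetD[OF ext] by simp
      qed simp
      then show ?thesis unfolding s by (rule subsetD[OF ext])
    qed
    then show ?case by (simp add: uniform_core_def)
  qed
  then show ?case by blast
qed

text \<open>Lists coding Bob's answers have the most recent one first, unlike positions.\<close>

primrec coded_position ::
    "(('b \<times> 'c) list \<Rightarrow> 'b) \<Rightarrow> (('b \<times> 'c) list \<Rightarrow> nat \<Rightarrow> 'c) \<Rightarrow> nat list \<Rightarrow> ('b \<times> 'c) list"
  where
  "coded_position \<sigma> \<beta> [] = []"
| "coded_position \<sigma> \<beta> (m # s) =
    coded_position \<sigma> \<beta> s @ [(\<sigma> (coded_position \<sigma> \<beta> s), \<beta> (coded_position \<sigma> \<beta> s) m)]"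

lemma positions_snoc:
  "p @ [(U, V)] \<in> positions \<A> \<longleftrightarrow> p \<in> positions \<A> \<and> U \<in> \<A> \<and> finite V \<and> V \<subseteq> U"
  by (auto simp: positions_def)

lemma compatible_snoc:
  "compatible \<sigma> (p @ [(U, V)]) \<longleftrightarrow> compatible \<sigma> p \<and> U = \<sigma> p"
  by (auto simp: compatible_def nth_append less_Suc_eq)

text \<open>The condition on \<open>\<beta>\<close> is asked at legal positions only, since
  countable subcovers are available only there; the induction keeps every coded position
  legal.\<close>

lemma coded_position_legal:
  assumes "alice_strategy \<A> \<sigma>"
    and "\<And>p m. p \<in> positions \<A> \<Longrightarrow> compatible \<sigma> p \<Longrightarrow> finite (\<beta> p m) \<and> \<beta> p m \<subseteq> \<sigma> p"
  shows "coded_position \<sigma> \<beta> s \<in> positions \<A> \<and> compatible \<sigma> (coded_position \<sigma> \<beta> s)"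
proof (induction s)
  case Nil
  show ?case by (simp add: positions_def compatible_def)
next
  case (Cons m s)
  then show ?case
    using assms by (simp add: positions_snoc compatible_snoc alice_strategy_def)
qed

text \<open>This makes legality and the sets \<open>U\<close>, known for coded positions, available
  along the infinite play that follows \<open>f\<close>.\<close>

lemma map_upt_eq_coded_position:
  assumes "\<And>n. r n = (\<sigma> (coded_position \<sigma> \<beta> (rev (map f [0..<n]))),
                       \<beta> (coded_position \<sigma> \<beta> (rev (map f [0..<n]))) (f n))"
  shows "map r [0..<n] = coded_position \<sigma> \<beta> (rev (map f [0..<n]))"
  by (induction n) (simp_all add: assms)

text \<open>Sublevel sets of an injection of \<open>W\<close> into the naturals; finite or empty
  \<open>W\<close> needs no separate case.\<close>

lemma countable_finite_exhaustion:
  assumes "countable W"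
  obtains g :: "nat \<Rightarrow> 'b set"
  where "mono g" and "\<And>m. finite (g m)" and "(\<Union>m. g m) = W"
proof
  let ?g = "\<lambda>m. {A \<in> W. to_nat_on W A \<le> m}"
  show "mono ?g" by (auto simp: mono_def)
  show "finite (?g m)" for m
  proof (rule finite_imageD)
    show "finite (to_nat_on W ` ?g m)" by (rule finite_subset[of _ "{..m}"]) auto
    show "inj_on (to_nat_on W) (?g m)"
      by (rule inj_on_subset[OF inj_on_to_nat_on[OF assms]]) auto
  qed
  show "(\<Union>m. ?g m) = W" by auto
qed

text \<open>This turns the finite selection that \<open>S_fin\<close> makes for an inning into the
  single number that codes Bob's answer.\<close>

lemma finite_subset_range_mono:
  fixes Q :: "nat \<Rightarrow> 'a set"
  assumes "mono Q" and "finite \<V>" and "\<V> \<subseteq> range Q"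
  shows "\<exists>k. \<Union>\<V> \<subseteq> Q k"
proof -
  obtain K where K: "finite K" "\<V> = Q ` K"
    using assms(2,3) by (meson finite_subset_image)
  \<comment> \<open>For empty \<open>K\<close> the value \<open>Max K\<close> is arbitrary, but then
    \<Union>\<V> is empty and any index serves.\<close>
  have "Q i \<subseteq> Q (Max K)" if "i \<in> K" for i
    using that K(1) by (intro monoD[OF assms(1)]) simp
  then show ?thesis using K(2) by blast
qed

theorem proposition3p5:
  fixes X :: "'a set" and L :: "'a filter \<Rightarrow> 'a set"
    and \<sigma> :: "('a set set \<times> 'a set set) list \<Rightarrow> 'a set set"
  assumes "convergence_space X L"
    and "S_fin (L_covers X L) (Cov X)"
    and "alice_strategy (L_covers X L) \<sigma>"
    and "\<And>p. p \<in> positions (L_covers X L) \<Longrightarrow> compatible \<sigma> p \<Longrightarrow>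
           \<exists>\<W>. \<W> \<subseteq> \<sigma> p \<and> countable \<W> \<and> \<W> \<in> L_covers X L"
  shows "\<not> alice_winning (L_covers X L) (Cov X) \<sigma>"
proof -
  define legal where "legal p \<longleftrightarrow> p \<in> positions (L_covers X L) \<and> compatible \<sigma> p" for p
  have "\<exists>g :: nat \<Rightarrow> 'a set set. mono g \<and> (\<forall>m. finite (g m)) \<and>
      (\<Union>m. g m) \<subseteq> \<sigma> p \<and> (\<Union>m. g m) \<in> L_covers X L" if "legal p" for p
  proof -
    obtain W where W: "W \<subseteq> \<sigma> p" "countable W" "W \<in> L_covers X L"
      using assms(4) \<open>legal p\<close> unfolding legal_def by blast
    then show ?thesis using countable_finite_exhaustion[OF W(2)] by metis
  qed
  then obtain \<beta> :: "('a set set \<times> 'a set set) list \<Rightarrow> nat \<Rightarrow> 'a set set" where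
    \<beta>_mono: "\<And>p. legal p \<Longrightarrow> mono (\<beta> p)" and
    \<beta>_fin: "\<And>p m. legal p \<Longrightarrow> finite (\<beta> p m)" and
    \<beta>_sub: "\<And>p. legal p \<Longrightarrow> (\<Union>m. \<beta> p m) \<subseteq> \<sigma> p" and
    \<beta>_cover: "\<And>p. legal p \<Longrightarrow> (\<Union>m. \<beta> p m) \<in> L_covers X L"
    by metis
  define pos where "pos = coded_position \<sigma> \<beta>"
  have legal: "legal (pos s)" for s
    unfolding pos_def legal_def
  proof (rule coded_position_legal[OF assms(3)])
    fix p m assume "p \<in> positions (L_covers X L)" "compatible \<sigma> p"
    then have "legal p" by (simp add: legal_def)
    then show "finite (\<beta> p m) \<and> \<beta> p m \<subseteq> \<sigma> p"
      using \<beta>_fin \<beta>_sub by blast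
  qed
  define U where "U s = \<Union> (\<Union> (snd ` set (pos s)))" for s
  have U_Cons: "U (m # s) = U s \<union> \<Union> (\<beta> (pos s) m)" for m s
    by (auto simp: U_def pos_def)
  have ext: "U s \<subseteq> U (m # s)" for m s
    by (simp add: U_Cons)
  \<comment> \<open>Only the latest entry may be raised: changing an earlier one can change Alice's
    later covers.\<close>
  have mono: "U (k # s) \<subseteq> U (m # s)" if "k \<le> m" for s k m
    using monoD[OF \<beta>_mono[OF legal[of s]] that] unfolding U_Cons by blast
  have U_X: "U s \<subseteq> X" for s
  proof (induction s)
    case Nil
    show ?case by (simp add: U_def pos_def)
  next
    case (Cons m s)
    then show ?case
      using \<beta>_cover[OF legal[of s]] unfolding U_Cons L_covers_def by blast
  qed
  have ev: "\<exists>m. \<forall>\<^sub>F x in F. x \<in> U (m # s)" if F: "F \<in> Fil X" "L F \<noteq> {}" for F s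
  proof -
    obtain A m where "A \<in> \<beta> (pos s) m" and A: "\<forall>\<^sub>F x in F. x \<in> A"
      using \<beta>_cover[OF legal[of s]] F unfolding L_covers_def by blast
    then have "A \<subseteq> U (m # s)" unfolding U_Cons by blast
    then have "\<forall>\<^sub>F x in F. x \<in> U (m # s)"
      by (intro eventually_mono[OF A]) (rule subsetD)
    then show ?thesis ..
  qed
  have core_cover: "range (uniform_core U n) \<in> L_covers X L" for n
  proof -
    have "uniform_core U n k \<subseteq> X" for k
      using uniform_core_subset[of "[]" n U k] U_X by auto
    moreover have "\<exists>k. \<forall>\<^sub>F x in F. x \<in> uniform_core U n k"
      if "F \<in> Fil X" "L F \<noteq> {}" for F
      by (rule uniform_core_eventually[OF ext mono ev[OF that]])
    ultimately show ?thesis unfolding L_covers_def by blast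
  qed
  then obtain \<V> where \<V>: "\<And>n. finite (\<V> n) \<and> \<V> n \<subseteq> range (uniform_core U n)"
    and \<V>_cov: "(\<Union>n. \<V> n) \<in> Cov X"
    using assms(2)[unfolded S_fin_def, rule_format, of "\<lambda>n. range (uniform_core U n)"] by blast
  have "mono (uniform_core U n)" for n
    by (intro monoI uniform_core_mono mono)
  then have "\<exists>k. \<Union>(\<V> n) \<subseteq> uniform_core U n k" for n
    using \<V> by (intro finite_subset_range_mono) auto
  then obtain f where f: "\<And>n. \<Union>(\<V> n) \<subseteq> uniform_core U n (f n)" by metis
  define code where "code n = rev (map f [0..<n])" for n
  define r where "r n = (\<sigma> (pos (code n)), \<beta> (pos (code n)) (f n))" for n
  have r_pos: "map r [0..<n] = pos (code n)" for n
    unfolding pos_def code_def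
    by (rule map_upt_eq_coded_position) (simp add: r_def pos_def code_def)
  have "\<Union>(\<V> n) \<subseteq> \<Union>(\<Union>i. snd (r i))" for n
  proof -
    \<comment> \<open>\<open>code (Suc n)\<close> is \<open>f n # code n\<close>, and
      \<open>code n\<close> has length exactly \<open>n\<close>, the bound allowed in
      \<open>uniform_core U n\<close>.\<close>
    have "\<Union>(\<V> n) \<subseteq> U (code (Suc n))"
      using f[of n] uniform_core_subset[of "code n" n U "f n"] by (auto simp: code_def)
    also have "\<dots> = \<Union> (\<Union> (snd ` set (map r [0..<Suc n])))"
      by (simp only: U_def r_pos)
    also have "\<dots> \<subseteq> \<Union>(\<Union>i. snd (r i))" by auto
    finally show ?thesis .
  qed
  then have "\<Union>(\<Union>n. \<V> n) \<subseteq> \<Union>(\<Union>i. snd (r i))"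
    by (simp add: Sup_le_iff)
  then have "X \<subseteq> \<Union>(\<Union>i. snd (r i))"
    using \<V>_cov by (simp add: Cov_def)
  moreover have "snd (r i) \<subseteq> Pow X" for i
    using \<beta>_cover[OF legal[of "code i"]] unfolding r_def L_covers_def by auto
  ultimately have "(\<Union>i. snd (r i)) \<in> Cov X"
    unfolding Cov_def by blast
  moreover have "map r [0..<n] \<in> positions (L_covers X L) \<and> compatible \<sigma> (map r [0..<n])" for n
    using legal[of "code n"] unfolding r_pos legal_def .
  ultimately show ?thesis
    unfolding alice_winning_def by blast
qed

end
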